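(* Let $\alpha\in[\frac12,1]$, $\lambda>0$, $K\in\mathbb N$ and $\delta=1/K$. The unique minimizer $\vec{\mathrm x}_\delta^{\min}\in\mathfrak x_\delta$ of $\mathbf H_{\alpha,\lambda}$ is a minimizer of $\mathbf F_{\alpha,\lambda}$ on $\mathfrak x_\delta$, and for every $\vec{\mathrm x}\in\mathfrak x_\delta$ $$\mathbf F_{\alpha,\lambda}(\vec{\mathrm x})-\mathbf F_{\alpha,\lambda}(\vec{\mathrm x}_\delta^{\min})\le\frac{2\alpha+1}{2}\,\|\nabla_\delta\mathbf H_{\alpha,\lambda}(\vec{\mathrm x})\|_\delta^2.$$
   Context: For $K\in\mathbb N$ put $\delta=1/K$ (the total mass is $M=1$). Let $\mathfrak x_\delta=\{\vec{\mathrm x}=(x_0,\dots,x_K)\in\mathbb R^{K+1}: x_0<x_1<\dots<x_K\}$. For $\vec{\mathrm x}\in\mathfrak x_\delta$ set $z_{k-\frac12}=\delta/(x_k-x_{k-1})$ for $k=1,\dots,K$ and $z_{-\frac12}=z_{K+\frac12}=0$. On $\mathbb R^{K+1}$ use the norm $\|\vec{\mathrm v}\|_\delta=\big(\delta\sum_{k=0}^K v_k^2\big)^{1/2}$, and for differentiable $f:\mathfrak x_\delta\to\mathbb R$ let $\nabla_\delta f(\vec{\mathrm x})\in\mathbb R^{K+1}$ have components $\delta^{-1}\partial_{x_k}f(\vec{\mathrm x})$, $k=0,\dots,K$. Constants: $\Theta_\alpha=\sqrt{2\alpha}/(2\alpha+1)$, $\Lambda_{\alpha,\lambda}=\sqrt{\lambda/(2\alpha+1)}$.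 Let $f_\alpha(s)=\Theta_\alpha\frac{s^{\alpha-1/2}}{\alpha-1/2}$ for $\alpha\in(\frac12,1]$ and $f_{1/2}(s)=\Theta_{1/2}\ln s$. The discrete entropy and discrete perturbed information functional on $\mathfrak x_\delta$ are $$\mathbf H_{\alpha,\lambda}(\vec{\mathrm x})=\delta\sum_{k=1}^K f_\alpha(z_{k-\frac12})+\frac{\Lambda_{\alpha,\lambda}}2\|\vec{\mathrm x}\|_\delta^2,\qquad \mathbf F_{\alpha,\lambda}(\vec{\mathrm x})=\Theta_\alpha^2\,\delta\sum_{k=0}^K\left(\frac{z_{k+\frac12}^{\alpha+\frac12}-z_{k-\frac12}^{\alpha+\frac12}}{\delta}\right)^2+\frac\lambda2\|\vec{\mathrm x}\|_\delta^2.$$ For $\lambda>0$, $\mathbf H_{\alpha,\lambda}$ has a unique minimizer in $\mathfrak x_\delta$. *)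

theory Defs
  imports "HOL-Analysis.Analysis"
begin

text \<open>
  A vector of \<open>\<real>\<^sup>K\<^sup>+\<^sup>1\<close> is a function \<^typ>\<open>nat \<Rightarrow> real\<close> that is extensional on the index
  set \<open>{..K}\<close>, so that equality of functions is equality of vectors and uniqueness of a
  minimizer has its intended meaning. The mass is normalised to \<open>1\<close>.
\<close>

definition mesh :: "nat \<Rightarrow> real" where
  "mesh K = 1 / real K"

definition config :: "nat \<Rightarrow> (nat \<Rightarrow> real) set" where
  "config K = {x \<in> {..K} \<rightarrow>\<^sub>E UNIV. \<forall>k<K. x k < x (Suc k)}"

text \<open>
  Half-integer indices are shifted up by one half: \<open>dens K x k\<close> is \<open>z\<close> at index \<open>k - 1/2\<close>.
  The values at \<open>k = 0\<close> and \<open>k = K + 1\<close> are the boundary convention \<open>0\<close>.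
\<close>

definition dens :: "nat \<Rightarrow> (nat \<Rightarrow> real) \<Rightarrow> nat \<Rightarrow> real" where
  "dens K x k = (if 1 \<le> k \<and> k \<le> K then mesh K / (x k - x (k - 1)) else 0)"

definition dnorm :: "nat \<Rightarrow> (nat \<Rightarrow> real) \<Rightarrow> real" where
  "dnorm K v = sqrt (mesh K * (\<Sum>k=0..K. (v k)\<^sup>2))"

text \<open>
  The \<open>k\<close>-th partial derivative is the derivative of \<open>f\<close> along the \<open>k\<close>-th coordinate line. For
  \<open>x \<in> config K\<close> and \<open>k \<le> K\<close> that line stays in \<open>config K\<close> near \<open>x\<close>, so only values of \<open>f\<close>
  on \<open>config K\<close> matter.
\<close>

definition dgrad :: "nat \<Rightarrow> ((nat \<Rightarrow> real) \<Rightarrow> real) \<Rightarrow> (nat \<Rightarrow> real) \<Rightarrow> nat \<Rightarrow> real" where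
  "dgrad K f x = (\<lambda>k\<in>{..K}. deriv (\<lambda>t. f (x(k := t))) (x k) / mesh K)"

definition Theta :: "real \<Rightarrow> real" where
  "Theta \<alpha> = sqrt (2 * \<alpha>) / (2 * \<alpha> + 1)"

definition Lambda :: "real \<Rightarrow> real \<Rightarrow> real" where
  "Lambda \<alpha> lam = sqrt (lam / (2 * \<alpha> + 1))"

definition ent :: "real \<Rightarrow> real \<Rightarrow> real" where
  "ent \<alpha> s = (if \<alpha> = 1/2 then Theta (1/2) * ln s
              else Theta \<alpha> * (s powr (\<alpha> - 1/2) / (\<alpha> - 1/2)))"

definition entropy :: "real \<Rightarrow> real \<Rightarrow> nat \<Rightarrow> (nat \<Rightarrow> real) \<Rightarrow> real" where
  "entropy \<alpha> lam K x =
     mesh K * (\<Sum>k=1..K. ent \<alpha> (dens K x k)) + Lambda \<alpha> lam / 2 * (dnorm K x)\<^sup>2"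

definition information :: "real \<Rightarrow> real \<Rightarrow> nat \<Rightarrow> (nat \<Rightarrow> real) \<Rightarrow> real" where
  "information \<alpha> lam K x =
     (Theta \<alpha>)\<^sup>2 * mesh K *
       (\<Sum>k=0..K. ((dens K x (k + 1) powr (\<alpha> + 1/2) - dens K x k powr (\<alpha> + 1/2)) / mesh K)\<^sup>2)
     + lam / 2 * (dnorm K x)\<^sup>2"

end

theory Submission
  imports Defs
begin

text \<open>
  Write \<open>H\<close>, \<open>F\<close> for the entropy and the information, \<open>\<delta>\<close> for the mesh, \<open>\<Theta>\<close>, \<open>\<Lambda>\<close> for the
  constants, \<open>G = \<nabla>\<^sub>\<delta> H\<close>, and \<open>w = z\<^sup>\<alpha>\<^sup>+\<^sup>1\<^sup>/\<^sup>2\<close> for the powers of the densities. Differentiating in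
  the node \<open>x k\<close>, which is an end point of at most two gaps, gives
  \<open>G k = \<Theta> (w (k + 1) - w k) / \<delta> + \<Lambda> x k\<close>. The two summands are, up to factors, exactly what is
  squared in the two parts of \<open>F\<close>.

  Expanding \<open>\<parallel>G\<parallel>\<^sup>2\<close> produces \<open>F\<close>, a multiple of \<open>\<parallel>x\<parallel>\<^sup>2\<close>, and a mixed term, which summation by
  parts turns into a sum of \<open>z\<^sup>\<alpha>\<^sup>-\<^sup>1\<^sup>/\<^sup>2\<close>. For \<open>\<alpha> > 1/2\<close> that power is a multiple of the integrand of
  \<open>H\<close>, for \<open>\<alpha> = 1/2\<close> it is constant, and the result in both cases
  (lemma \<open>information_diff\<close>) is that \<open>F - \<parallel>G\<parallel>\<^sup>2 - (2 \<alpha> - 1) \<Lambda> H\<close> is constant.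

  Moreover \<open>H\<close> is \<open>\<Lambda>\<close>-convex (lemma \<open>entropy_strongly_convex\<close>), because the integrand is a convex
  function of the gap. Hence \<open>2 \<Lambda> (H x - H m) \<le> \<parallel>G x\<parallel>\<^sup>2\<close> (lemma \<open>entropy_gradient_domination\<close>).
  At the minimizer \<open>m\<close> of \<open>H\<close> the gradient vanishes, so that
  \<open>F x - F m = \<parallel>G x\<parallel>\<^sup>2 + (2 \<alpha> - 1) \<Lambda> (H x - H m)\<close>. This is nonnegative, and it is at most
  \<open>(1 + (2 \<alpha> - 1) / 2) \<parallel>G x\<parallel>\<^sup>2\<close>, which is the claim.

  Uniqueness of \<open>m\<close> is again \<open>\<Lambda>\<close>-convexity. For existence, \<open>\<Lambda>\<close>-convexity bounds the nodes on a
  sublevel set of \<open>H\<close>, and blow-up of the integrand at high density keeps them apart, so the sublevel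
  set lies in a compact set of configurations.
\<close>

lemma Theta_pos: "1/2 \<le> \<alpha> \<Longrightarrow> Theta \<alpha> > 0"
  by (simp add: Theta_def)

lemma Lambda_pos: "1/2 \<le> \<alpha> \<Longrightarrow> lam > 0 \<Longrightarrow> Lambda \<alpha> lam > 0"
  by (simp add: Lambda_def)

lemma Lambda_squared: "1/2 \<le> \<alpha> \<Longrightarrow> lam > 0 \<Longrightarrow> (2 * \<alpha> + 1) * (Lambda \<alpha> lam)\<^sup>2 = lam"
  by (simp add: Lambda_def)

lemma mesh_pos: "K \<ge> 1 \<Longrightarrow> mesh K > 0"
  by (simp add: mesh_def)

lemma dnorm_squared: "(dnorm K v)\<^sup>2 = mesh K * (\<Sum>k=0..K. (v k)\<^sup>2)"
  unfolding dnorm_def mesh_def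
  by (subst real_sqrt_pow2) (auto intro!: divide_nonneg_nonneg sum_nonneg)

lemma dens_interior: "1 \<le> k \<Longrightarrow> k \<le> K \<Longrightarrow> dens K x k = mesh K / (x k - x (k - 1))"
  by (simp add: dens_def)

lemma config_gap_pos:
  assumes "x \<in> config K" "1 \<le> k" "k \<le> K"
  shows "0 < x k - x (k - 1)"
proof -
  have "k - 1 < K" "Suc (k - 1) = k" using assms by auto
  then show ?thesis using assms(1) unfolding config_def
    by (metis (no_types, lifting) diff_gt_0_iff_gt mem_Collect_eq)
qed

section \<open>The specific entropy as a function of the gap\<close>

text \<open>
  The derivative has one formula for all \<open>\<alpha>\<close>, which removes the distinction between the
  logarithm and the powers from the convexity and gradient computations.
\<close>
lemma ent_has_derivative:
  assumes "s > 0" "1/2 \<le> \<alpha>"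
  shows "(ent \<alpha> has_real_derivative Theta \<alpha> * s powr (\<alpha> - 3/2)) (at s)"
proof (cases "\<alpha> = 1/2")
  case True
  have "((\<lambda>s. Theta (1/2) * ln s) has_real_derivative Theta (1/2) * s powr (1/2 - 3/2)) (at s)"
    using assms by (auto intro!: derivative_eq_intros simp: powr_minus_divide)
  then show ?thesis unfolding True ent_def by simp
next
  case False
  have "((\<lambda>s. Theta \<alpha> * (s powr (\<alpha> - 1/2) / (\<alpha> - 1/2))) has_real_derivative
          Theta \<alpha> * s powr (\<alpha> - 3/2)) (at s)"
    using assms False by (auto intro!: derivative_eq_intros simp: divide_simps)
  then show ?thesis using False unfolding ent_def by simp
qed

lemma ent_mono:
  assumes "0 < s" "s \<le> t" "1/2 \<le> \<alpha>"
  shows "ent \<alpha> s \<le> ent \<alpha> t"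
  using assms Theta_pos[of \<alpha>] Theta_pos[of "1/2"]
  by (auto simp: ent_def intro!: mult_left_mono divide_right_mono powr_mono2)

text \<open>
  High densities are infinitely costly. This is what separates neighbouring nodes of configurations
  of bounded entropy.
\<close>
lemma ent_unbounded:
  assumes "1/2 \<le> \<alpha>"
  obtains s where "s > 0" "ent \<alpha> s > U"
proof (cases "\<alpha> = 1/2")
  case True
  have "ent \<alpha> (exp ((\<bar>U\<bar> + 1) / Theta (1/2))) > U"
    using Theta_pos[of "1/2"] by (simp add: True ent_def)
  then show ?thesis using that by (meson exp_gt_zero)
next
  case False
  then have p: "\<alpha> - 1/2 > 0" using assms by simp
  define c where "c = (\<bar>U\<bar> + 1) * (\<alpha> - 1/2) / Theta \<alpha>"
  have c: "c > 0" using p Theta_pos[OF assms] unfolding c_def by simp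
  have "(c powr (1 / (\<alpha> - 1/2))) powr (\<alpha> - 1/2) = c"
    using c p by (simp add: powr_powr)
  then have "ent \<alpha> (c powr (1 / (\<alpha> - 1/2))) = Theta \<alpha> * (c / (\<alpha> - 1/2))"
    using False by (simp only: ent_def if_False)
  also have "\<dots> = \<bar>U\<bar> + 1"
    using p Theta_pos[OF assms] unfolding c_def by simp
  finally show ?thesis using that[of "c powr (1 / (\<alpha> - 1/2))"] c by simp
qed

lemma ent_gap_derivative:
  assumes "d > 0" "m > 0" "1/2 \<le> \<alpha>"
  shows "((\<lambda>t. ent \<alpha> (m / t)) has_real_derivative - (Theta \<alpha> / m) * (m / d) powr (\<alpha> + 1/2)) (at d)"
proof -
  have inner: "((\<lambda>t. m / t) has_real_derivative - m / d\<^sup>2) (at d)"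
    using assms by (auto intro!: derivative_eq_intros simp: power2_eq_square)
  have "(m / d) powr (\<alpha> + 1/2) = (m / d) powr (\<alpha> - 3/2) * (m / d) powr 2"
    by (simp flip: powr_add add: add.commute)
  also have "(m / d) powr 2 = (m / d)\<^sup>2" using assms by simp
  finally have "- (Theta \<alpha> / m) * (m / d) powr (\<alpha> + 1/2)
      = Theta \<alpha> * (m / d) powr (\<alpha> - 3/2) * (- m / d\<^sup>2)"
    using assms by (simp add: power2_eq_square)
  then show ?thesis
    using DERIV_chain2[OF ent_has_derivative inner] assms by simp
qed

text \<open>
  The derivative above increases with the gap, because the density decreases. Convexity in the gap,
  rather than in the density, is what makes the entropy convex in the nodes: gaps are linear in the nodes.
\<close>
lemma ent_gap_above_tangent:
  assumes "d > 0" "e > 0" "m > 0" "1/2 \<le> \<alpha>"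
  shows "ent \<alpha> (m / e) \<ge> ent \<alpha> (m / d) - (Theta \<alpha> / m) * (m / d) powr (\<alpha> + 1/2) * (e - d)"
proof -
  have "convex_on {0<..} (\<lambda>t. ent \<alpha> (m / t))"
  proof (rule convex_on_realI)
    show "connected {0::real<..}" by simp
    show "((\<lambda>t. ent \<alpha> (m / t)) has_real_derivative - (Theta \<alpha> / m) * (m / t) powr (\<alpha> + 1/2)) (at t)"
      if "t \<in> {0<..}" for t using ent_gap_derivative that assms by simp
    show "- (Theta \<alpha> / m) * (m / s) powr (\<alpha> + 1/2) \<le> - (Theta \<alpha> / m) * (m / t) powr (\<alpha> + 1/2)"
      if "s \<in> {0<..}" "t \<in> {0<..}" "s \<le> t" for s t
    proof -
      have "(m / t) powr (\<alpha> + 1/2) \<le> (m / s) powr (\<alpha> + 1/2)"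
        using that assms by (intro powr_mono2 divide_left_mono) auto
      then show ?thesis using assms Theta_pos[of \<alpha>] by (simp add: mult_left_mono divide_right_mono)
    qed
  qed
  then have "- (Theta \<alpha> / m) * (m / d) powr (\<alpha> + 1/2) * (e - d) \<le> ent \<alpha> (m / e) - ent \<alpha> (m / d)"
    using assms
    by (intro convex_on_imp_above_tangent has_field_derivative_at_within[OF ent_gap_derivative])
       (auto simp: interior_open)
  then show ?thesis by simp
qed

section \<open>The gradient of the entropy\<close>

text \<open>
  The powers of the densities whose differences appear in the information. By the lemma
  \<open>ent_gap_derivative\<close> they are also, up to a negative factor, the derivatives of the specific
  entropy with respect to the gaps.
\<close>
definition flux :: "real \<Rightarrow> nat \<Rightarrow> (nat \<Rightarrow> real) \<Rightarrow> nat \<Rightarrow> real" where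
  "flux \<alpha> K x k = dens K x k powr (\<alpha> + 1/2)"

lemma flux_boundary [simp]: "flux \<alpha> K x 0 = 0" "flux \<alpha> K x (Suc K) = 0"
  by (simp_all add: flux_def dens_def)

lemma sum_by_parts:
  fixes u w :: "nat \<Rightarrow> real"
  shows "(\<Sum>k=0..K. u k * (w (Suc k) - w k))
    = u K * w (Suc K) - u 0 * w 0 - (\<Sum>k=1..K. w k * (u k - u (k - 1)))"
  by (induction K) (auto simp: algebra_simps)

lemma sum_flux_by_parts:
  "(\<Sum>k=0..K. u k * (flux \<alpha> K x (Suc k) - flux \<alpha> K x k))
    = - (\<Sum>k=1..K. flux \<alpha> K x k * (u k - u (k - 1)))"
  by (simp add: sum_by_parts)

text \<open>
  The closed form of \<open>dgrad\<close> of the entropy, which \<open>dgrad_entropy\<close> justifies; unlike \<open>dgrad\<close>, it can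
  be squared and summed without reference to derivatives.
\<close>
definition grad :: "real \<Rightarrow> real \<Rightarrow> nat \<Rightarrow> (nat \<Rightarrow> real) \<Rightarrow> nat \<Rightarrow> real" where
  "grad \<alpha> lam K x k = Theta \<alpha> * ((flux \<alpha> K x (Suc k) - flux \<alpha> K x k) / mesh K) + Lambda \<alpha> lam * x k"

text \<open>
  The gap below node \<open>j\<close> changes at rate \<open>[j = k] - [j - 1 = k]\<close> when node \<open>k\<close> moves. Summation by
  parts, applied to the indicator of \<open>k\<close>, moves this difference onto the fluxes and handles the end
  nodes \<open>0\<close> and \<open>K\<close> together with the interior ones, as the fluxes vanish beyond the ends.
\<close>
lemma entropy_partial_derivative:
  assumes "1/2 \<le> \<alpha>" "K \<ge> 1" "x \<in> config K" "k \<le> K"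
  shows "((\<lambda>t. entropy \<alpha> lam K (x(k := t))) has_real_derivative mesh K * grad \<alpha> lam K x k) (at (x k))"
proof -
  have coord: "((\<lambda>t. (x(k := t)) j) has_real_derivative of_bool (j = k)) (at (x k))" for j
    by (cases "j = k") auto
  have gap: "((\<lambda>t. ent \<alpha> (dens K (x(k := t)) j)) has_real_derivative
      - (Theta \<alpha> / mesh K) * flux \<alpha> K x j * (of_bool (j = k) - of_bool (j - 1 = k))) (at (x k))"
    if j: "j \<in> {1..K}" for j
  proof -
    have "((\<lambda>t. ent \<alpha> (mesh K / ((x(k := t)) j - (x(k := t)) (j - 1)))) has_real_derivative
        - (Theta \<alpha> / mesh K) * (mesh K / ((x(k := x k)) j - (x(k := x k)) (j - 1))) powr (\<alpha> + 1/2)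
         * (of_bool (j = k) - of_bool (j - 1 = k))) (at (x k))"
      using j config_gap_pos[OF assms(3)] mesh_pos[OF assms(2)] assms(1)
      by (intro DERIV_chain2[OF ent_gap_derivative] DERIV_diff coord) auto
    then show ?thesis using j by (simp add: dens_def flux_def)
  qed
  have int: "((\<lambda>t. \<Sum>j=1..K. ent \<alpha> (dens K (x(k := t)) j)) has_real_derivative
      (\<Sum>j=1..K. - (Theta \<alpha> / mesh K) * flux \<alpha> K x j * (of_bool (j = k) - of_bool (j - 1 = k)))) (at (x k))"
    by (intro DERIV_sum gap)
  have "(\<Sum>j=1..K. - (Theta \<alpha> / mesh K) * flux \<alpha> K x j * (of_bool (j = k) - of_bool (j - 1 = k)))
      = Theta \<alpha> / mesh K * - (\<Sum>j=1..K. flux \<alpha> K x j * (of_bool (j = k) - of_bool (j - 1 = k)))"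
    by (simp add: sum_distrib_left sum_negf mult.assoc)
  also have "\<dots> = Theta \<alpha> / mesh K * (\<Sum>j=0..K. of_bool (j = k) * (flux \<alpha> K x (Suc j) - flux \<alpha> K x j))"
    by (simp add: sum_flux_by_parts)
  also have "(\<Sum>j=0..K. of_bool (j = k) * (flux \<alpha> K x (Suc j) - flux \<alpha> K x j))
      = (\<Sum>j=0..K. if j = k then flux \<alpha> K x (Suc j) - flux \<alpha> K x j else 0)"
    by (intro sum.cong) auto
  also have "\<dots> = flux \<alpha> K x (Suc k) - flux \<alpha> K x k"
    using assms(4) by (simp add: sum.delta)
  finally have int': "((\<lambda>t. \<Sum>j=1..K. ent \<alpha> (dens K (x(k := t)) j)) has_real_derivative
      Theta \<alpha> / mesh K * (flux \<alpha> K x (Suc k) - flux \<alpha> K x k)) (at (x k))"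
    using int by simp
  have sq: "((\<lambda>t. \<Sum>j=0..K. ((x(k := t)) j)\<^sup>2) has_real_derivative
      (\<Sum>j=0..K. if j = k then 2 * x j else 0)) (at (x k))"
  proof (intro DERIV_sum)
    show "((\<lambda>t. ((x(k := t)) j)\<^sup>2) has_real_derivative (if j = k then 2 * x j else 0)) (at (x k))" for j
      by (cases "j = k") (auto intro!: derivative_eq_intros)
  qed
  have sq': "((\<lambda>t. \<Sum>j=0..K. ((x(k := t)) j)\<^sup>2) has_real_derivative 2 * x k) (at (x k))"
    using sq assms(4) by (simp add: sum.delta)
  have "((\<lambda>t. mesh K * (\<Sum>j=1..K. ent \<alpha> (dens K (x(k := t)) j))
        + Lambda \<alpha> lam / 2 * (mesh K * (\<Sum>j=0..K. ((x(k := t)) j)\<^sup>2))) has_real_derivative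
      mesh K * (Theta \<alpha> / mesh K * (flux \<alpha> K x (Suc k) - flux \<alpha> K x k))
        + Lambda \<alpha> lam / 2 * (mesh K * (2 * x k))) (at (x k))"
    by (intro DERIV_add DERIV_cmult int' sq')
  then show ?thesis
    unfolding entropy_def dnorm_squared grad_def
    using mesh_pos[OF assms(2)] by (simp add: field_simps)
qed

lemma dgrad_entropy:
  assumes "1/2 \<le> \<alpha>" "K \<ge> 1" "x \<in> config K" "k \<le> K"
  shows "dgrad K (entropy \<alpha> lam K) x k = grad \<alpha> lam K x k"
  using DERIV_imp_deriv[OF entropy_partial_derivative[OF assms]] mesh_pos[OF assms(2)] assms(4)
  by (simp add: dgrad_def)

lemma dnorm_dgrad_entropy:
  assumes "1/2 \<le> \<alpha>" "K \<ge> 1" "x \<in> config K"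
  shows "(dnorm K (dgrad K (entropy \<alpha> lam K) x))\<^sup>2 = mesh K * (\<Sum>k=0..K. (grad \<alpha> lam K x k)\<^sup>2)"
  unfolding dnorm_squared using dgrad_entropy[OF assms] by simp

text \<open>
  Configurations are open along coordinate lines, so that a minimizer is a critical point.
\<close>
lemma eventually_config_update:
  assumes "x \<in> config K" "k \<le> K"
  shows "\<forall>\<^sub>F t in nhds (x k). x(k := t) \<in> config K"
proof -
  have "\<forall>\<^sub>F t in nhds (x k). \<forall>j\<in>{..<K}. 0 < (x(k := t)) (Suc j) - (x(k := t)) j"
  proof (intro eventually_ball_finite ballI)
    fix j assume "j \<in> {..<K}"
    then have pos: "0 < x (Suc j) - x j" using assms by (simp add: config_def)
    have "((\<lambda>t. (x(k := t)) i) \<longlongrightarrow> x i) (nhds (x k))" for i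
      by (cases "i = k") (auto intro: filterlim_ident)
    then have "((\<lambda>t. (x(k := t)) (Suc j) - (x(k := t)) j) \<longlongrightarrow> x (Suc j) - x j) (nhds (x k))"
      by (intro tendsto_diff)
    from order_tendstoD(1)[OF this pos]
    show "\<forall>\<^sub>F t in nhds (x k). 0 < (x(k := t)) (Suc j) - (x(k := t)) j" .
  qed simp
  moreover have "x(k := t) \<in> {..K} \<rightarrow>\<^sub>E UNIV" for t
    using assms by (auto simp: config_def PiE_def extensional_def)
  ultimately show ?thesis
    unfolding config_def by (simp only: mem_Collect_eq simp_thms Ball_def lessThan_iff diff_gt_0_iff_gt)
qed

lemma grad_minimizer_eq_0:
  assumes "1/2 \<le> \<alpha>" "K \<ge> 1" "is_arg_min (entropy \<alpha> lam K) (\<lambda>x. x \<in> config K) m" "k \<le> K"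
  shows "grad \<alpha> lam K m k = 0"
proof -
  have m: "m \<in> config K" and min: "\<And>y. y \<in> config K \<Longrightarrow> entropy \<alpha> lam K m \<le> entropy \<alpha> lam K y"
    using assms(3) by (auto simp: is_arg_min_linorder)
  obtain e where e: "e > 0" "\<And>t. dist t (m k) < e \<Longrightarrow> m(k := t) \<in> config K"
    using eventually_config_update[OF m assms(4)] unfolding eventually_nhds_metric by blast
  have "mesh K * grad \<alpha> lam K m k = 0"
    using e min
    by (intro DERIV_local_min[OF entropy_partial_derivative[OF assms(1,2) m assms(4)], of e])
       (auto simp: dist_real_def abs_minus_commute)
  then show ?thesis using mesh_pos[OF assms(2)] by simp
qed

section \<open>Strong convexity of the entropy\<close>

text \<open>
  Summing the tangent inequality over all gaps gives a linear term in the increments of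
  \<open>y - x\<close>; summation by parts turns it into the flux part of the gradient. The quadratic part of the
  entropy contributes the rest of the gradient and, being exactly quadratic, the term with \<open>\<Lambda>/2\<close>.
\<close>
lemma entropy_strongly_convex:
  assumes "1/2 \<le> \<alpha>" "K \<ge> 1" "x \<in> config K" "y \<in> config K"
  shows "entropy \<alpha> lam K y - entropy \<alpha> lam K x
    \<ge> mesh K * (\<Sum>k=0..K. grad \<alpha> lam K x k * (y k - x k) + Lambda \<alpha> lam / 2 * (y k - x k)\<^sup>2)"
proof -
  define T where "T = Theta \<alpha> / mesh K"
  define u where "u k = y k - x k" for k
  have "ent \<alpha> (dens K y k) \<ge> ent \<alpha> (dens K x k) - T * (flux \<alpha> K x k * (u k - u (k - 1)))"
    if k: "k \<in> {1..K}" for k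
    using k ent_gap_above_tangent[OF config_gap_pos[OF assms(3)] config_gap_pos[OF assms(4)]
        mesh_pos[OF assms(2)] assms(1), of k k]
    by (simp add: dens_interior flux_def T_def u_def algebra_simps add_divide_distrib diff_divide_distrib)
  then have "(\<Sum>k=1..K. ent \<alpha> (dens K y k))
      \<ge> (\<Sum>k=1..K. ent \<alpha> (dens K x k) - T * (flux \<alpha> K x k * (u k - u (k - 1))))"
    by (intro sum_mono) auto
  then have "(\<Sum>k=1..K. ent \<alpha> (dens K y k)) - (\<Sum>k=1..K. ent \<alpha> (dens K x k))
      \<ge> T * - (\<Sum>k=1..K. flux \<alpha> K x k * (u k - u (k - 1)))"
    by (simp add: sum_subtractf sum_distrib_left)
  then have *: "(\<Sum>k=1..K. ent \<alpha> (dens K y k)) - (\<Sum>k=1..K. ent \<alpha> (dens K x k))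
      \<ge> T * (\<Sum>k=0..K. u k * (flux \<alpha> K x (Suc k) - flux \<alpha> K x k))"
    by (simp only: sum_flux_by_parts)
  have **: "(\<Sum>k=0..K. (y k)\<^sup>2) - (\<Sum>k=0..K. (x k)\<^sup>2) = (\<Sum>k=0..K. 2 * x k * u k + (u k)\<^sup>2)"
    by (simp flip: sum_subtractf add: u_def power2_eq_square algebra_simps)
  have "(\<Sum>k=0..K. grad \<alpha> lam K x k * u k + Lambda \<alpha> lam / 2 * (u k)\<^sup>2)
     = T * (\<Sum>k=0..K. u k * (flux \<alpha> K x (Suc k) - flux \<alpha> K x k))
       + Lambda \<alpha> lam / 2 * (\<Sum>k=0..K. 2 * x k * u k + (u k)\<^sup>2)"
    unfolding sum_distrib_left sum.distrib[symmetric]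
    by (intro sum.cong) (auto simp: grad_def T_def algebra_simps add_divide_distrib diff_divide_distrib)
  also have "\<dots> \<le> (\<Sum>k=1..K. ent \<alpha> (dens K y k)) - (\<Sum>k=1..K. ent \<alpha> (dens K x k))
       + Lambda \<alpha> lam / 2 * ((\<Sum>k=0..K. (y k)\<^sup>2) - (\<Sum>k=0..K. (x k)\<^sup>2))"
    using * ** by simp
  finally have "mesh K * (\<Sum>k=0..K. grad \<alpha> lam K x k * u k + Lambda \<alpha> lam / 2 * (u k)\<^sup>2)
    \<le> mesh K * ((\<Sum>k=1..K. ent \<alpha> (dens K y k)) - (\<Sum>k=1..K. ent \<alpha> (dens K x k))
       + Lambda \<alpha> lam / 2 * ((\<Sum>k=0..K. (y k)\<^sup>2) - (\<Sum>k=0..K. (x k)\<^sup>2)))"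
    using mesh_pos[OF assms(2)] by (intro mult_left_mono) auto
  then show ?thesis unfolding entropy_def dnorm_squared u_def by (simp add: algebra_simps)
qed

text \<open>
  A Polyak--Lojasiewicz inequality: the lower bound of \<open>entropy_strongly_convex\<close> is minimized over all
  displacements, node by node, by completing the square.
\<close>
lemma entropy_gradient_domination:
  assumes "1/2 \<le> \<alpha>" "lam > 0" "K \<ge> 1" "x \<in> config K" "y \<in> config K"
  shows "2 * Lambda \<alpha> lam * (entropy \<alpha> lam K x - entropy \<alpha> lam K y)
    \<le> mesh K * (\<Sum>k=0..K. (grad \<alpha> lam K x k)\<^sup>2)"
proof -
  define L where "L = Lambda \<alpha> lam"
  have L: "L > 0" using Lambda_pos assms by (simp add: L_def)
  \<comment> \<open>The difference of the two sides is \<open>(g + L u)\<^sup>2\<close>.\<close>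
  have "- (g\<^sup>2) \<le> 2 * L * (g * u + L / 2 * u\<^sup>2)" for g u :: real
    using zero_le_power2[of "g + L * u"] by (simp add: power2_eq_square algebra_simps)
  then have "- (\<Sum>k=0..K. (grad \<alpha> lam K x k)\<^sup>2)
      \<le> 2 * L * (\<Sum>k=0..K. grad \<alpha> lam K x k * (y k - x k) + L / 2 * (y k - x k)\<^sup>2)"
    unfolding sum_distrib_left sum_negf[symmetric] by (intro sum_mono)
  then have "mesh K * - (\<Sum>k=0..K. (grad \<alpha> lam K x k)\<^sup>2)
      \<le> 2 * L * (mesh K * (\<Sum>k=0..K. grad \<alpha> lam K x k * (y k - x k) + L / 2 * (y k - x k)\<^sup>2))"
    unfolding mult.left_commute[of "2 * L"] using mesh_pos[OF assms(3)]
    by (intro mult_left_mono) auto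
  also have "\<dots> \<le> 2 * L * (entropy \<alpha> lam K y - entropy \<alpha> lam K x)"
    using entropy_strongly_convex[OF assms(1,3,4,5)] L by (intro mult_left_mono) (auto simp: L_def)
  finally show ?thesis by (simp add: L_def algebra_simps)
qed

text \<open>
  The quadratic term of the strong convexity beats the linear one at large distances. The lemma serves
  twice: at a critical point \<open>x\<close> it gives uniqueness, and at an arbitrary \<open>x\<close> it gives coercivity.
\<close>
lemma entropy_sublevel_near:
  assumes "1/2 \<le> \<alpha>" "lam > 0" "K \<ge> 1" "x \<in> config K" "y \<in> config K"
    and "entropy \<alpha> lam K y \<le> entropy \<alpha> lam K x"
  shows "(Lambda \<alpha> lam)\<^sup>2 * (\<Sum>k=0..K. (y k - x k)\<^sup>2) \<le> 4 * (\<Sum>k=0..K. (grad \<alpha> lam K x k)\<^sup>2)"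
proof -
  define L where "L = Lambda \<alpha> lam"
  have L: "L > 0" using Lambda_pos assms by (simp add: L_def)
  \<comment> \<open>The difference of the two sides is \<open>(2 g + L u)\<^sup>2\<close>.\<close>
  have "L\<^sup>2 * u\<^sup>2 - 4 * g\<^sup>2 \<le> 4 * L * (g * u + L / 2 * u\<^sup>2)" for g u :: real
    using zero_le_power2[of "2 * g + L * u"] by (simp add: power2_eq_square algebra_simps)
  then have "L\<^sup>2 * (\<Sum>k=0..K. (y k - x k)\<^sup>2) - 4 * (\<Sum>k=0..K. (grad \<alpha> lam K x k)\<^sup>2)
      \<le> 4 * L * (\<Sum>k=0..K. grad \<alpha> lam K x k * (y k - x k) + L / 2 * (y k - x k)\<^sup>2)"
    unfolding sum_distrib_left sum_subtractf[symmetric] by (intro sum_mono)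
  also have "\<dots> \<le> 0"
  proof -
    have "mesh K * (\<Sum>k=0..K. grad \<alpha> lam K x k * (y k - x k) + L / 2 * (y k - x k)\<^sup>2) \<le> 0"
      using entropy_strongly_convex[OF assms(1,3,4,5), of lam] assms(6) by (simp add: L_def)
    then show ?thesis using mesh_pos[OF assms(3)] L by (simp add: mult_le_0_iff)
  qed
  finally show ?thesis by (simp add: L_def)
qed

lemma entropy_minimizer_unique:
  assumes "1/2 \<le> \<alpha>" "lam > 0" "K \<ge> 1"
    and m: "is_arg_min (entropy \<alpha> lam K) (\<lambda>x. x \<in> config K) m"
    and n: "is_arg_min (entropy \<alpha> lam K) (\<lambda>x. x \<in> config K) n"
  shows "m = n"
proof -
  have mn: "m \<in> config K" "n \<in> config K" "entropy \<alpha> lam K n \<le> entropy \<alpha> lam K m"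
    using m n by (auto simp: is_arg_min_linorder)
  have "(Lambda \<alpha> lam)\<^sup>2 * (\<Sum>k=0..K. (n k - m k)\<^sup>2) \<le> 0"
    using entropy_sublevel_near[OF assms(1-3) mn] grad_minimizer_eq_0[OF assms(1,3) m] by simp
  then have "(\<Sum>k=0..K. (n k - m k)\<^sup>2) \<le> 0"
    using Lambda_pos[OF assms(1,2)] by (simp add: mult_le_0_iff)
  then have "(\<Sum>k=0..K. (n k - m k)\<^sup>2) = 0"
    by (intro antisym sum_nonneg) auto
  then have "\<forall>k\<in>{0..K}. n k = m k"
    by (subst (asm) sum_nonneg_eq_0_iff) auto
  then show ?thesis
    using mn(1,2) by (intro PiE_ext[of m "{..K}" "\<lambda>_. UNIV" n]) (auto simp: config_def)
qed

section \<open>Existence of a minimizer\<close>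

text \<open>
  When the nodes stay in \<open>[-R, R]\<close>, no gap exceeds \<open>2 R\<close>, so each summand of the entropy is at least
  \<open>l = ent \<alpha> (\<delta> / (2 R))\<close>. A bound on the whole sum then bounds every single summand from above, and
  \<open>ent_unbounded\<close> excludes densities above some \<open>s\<close>.
\<close>
lemma entropy_sublevel_gap:
  assumes "1/2 \<le> \<alpha>" "lam > 0" "K \<ge> 1"
  obtains \<epsilon> where "\<epsilon> > 0"
    "\<And>y k. y \<in> config K \<Longrightarrow> entropy \<alpha> lam K y \<le> C \<Longrightarrow> (\<And>j. j \<le> K \<Longrightarrow> \<bar>y j\<bar> \<le> R)
      \<Longrightarrow> k \<in> {1..K} \<Longrightarrow> \<epsilon> \<le> y k - y (k - 1)"
proof -
  define l where "l = ent \<alpha> (mesh K / (2 * R))"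
  obtain s where s: "s > 0" "ent \<alpha> s > C / mesh K - real K * l + l"
    using ent_unbounded[OF assms(1)] .
  have mp: "mesh K > 0" using mesh_pos[OF assms(3)] .
  show ?thesis
  proof (rule that[of "mesh K / s"])
    show "mesh K / s > 0" using mp s by simp
    fix y k assume y: "y \<in> config K" "entropy \<alpha> lam K y \<le> C" "\<And>j. j \<le> K \<Longrightarrow> \<bar>y j\<bar> \<le> R"
      and k: "k \<in> {1..K}"
    have low: "l \<le> ent \<alpha> (dens K y j)" if j: "j \<in> {1..K}" for j
    proof -
      have "j \<le> K" "j - 1 \<le> K" using j by auto
      from abs_le_D1[OF y(3)[OF this(1)]] abs_le_D2[OF y(3)[OF this(2)]]
      have "y j - y (j - 1) \<le> 2 * R" by linarith
      moreover have "0 < y j - y (j - 1)" using config_gap_pos[OF y(1)] j by simp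
      ultimately show ?thesis unfolding l_def using j mp assms(1)
        by (intro ent_mono) (auto simp: dens_interior intro!: divide_left_mono)
    qed
    have "mesh K * (\<Sum>j=1..K. ent \<alpha> (dens K y j)) \<le> C"
      using y(2) Lambda_pos[OF assms(1,2)] unfolding entropy_def
      by (smt (verit) divide_pos_pos mult_nonneg_nonneg zero_le_power2)
    then have "(\<Sum>j=1..K. ent \<alpha> (dens K y j)) \<le> C / mesh K"
      using mp by (simp add: field_simps)
    then have "(\<Sum>j=1..K. ent \<alpha> (dens K y j) - l) \<le> C / mesh K - real K * l"
      by (simp add: sum_subtractf)
    moreover have "ent \<alpha> (dens K y k) - l \<le> (\<Sum>j=1..K. ent \<alpha> (dens K y j) - l)"
      using low k by (intro member_le_sum) auto
    ultimately have "ent \<alpha> (dens K y k) < ent \<alpha> s" using s(2) by linarith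
    then have "dens K y k < s"
      using ent_mono[OF s(1) _ assms(1), of "dens K y k"] by linarith
    then show "mesh K / s \<le> y k - y (k - 1)"
      using k config_gap_pos[OF y(1), of k] s(1) by (simp add: dens_interior field_simps)
  qed
qed

lemma continuous_on_coordinate: "continuous_on S (\<lambda>x::nat \<Rightarrow> real. x k)"
  by (rule continuous_on_subset[OF continuous_on_product_coordinates]) simp

text \<open>
  All configurations with at most the entropy of the equispaced one lie in a compact set of
  configurations with bounded nodes and gaps bounded below, on which the entropy is continuous.
\<close>
lemma entropy_minimizer_exists:
  assumes "1/2 \<le> \<alpha>" "lam > 0" "K \<ge> 1"
  shows "\<exists>m. is_arg_min (entropy \<alpha> lam K) (\<lambda>x. x \<in> config K) m"
proof -
  define a where "a = (\<lambda>k\<in>{..K}. real k)"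
  have a: "a \<in> config K" by (auto simp: a_def config_def)
  define G where "G = 4 * (\<Sum>k=0..K. (grad \<alpha> lam K a k)\<^sup>2) / (Lambda \<alpha> lam)\<^sup>2"
  define R where "R = real K + sqrt G"
  have bound: "\<bar>y k\<bar> \<le> R"
    if y: "y \<in> config K" "entropy \<alpha> lam K y \<le> entropy \<alpha> lam K a" and k: "k \<le> K" for y k
  proof -
    have "(y k - a k)\<^sup>2 \<le> (\<Sum>k=0..K. (y k - a k)\<^sup>2)"
      using k by (intro member_le_sum) auto
    also have "\<dots> \<le> G"
      using entropy_sublevel_near[OF assms a y] Lambda_pos[OF assms(1,2)]
      by (simp add: G_def field_simps)
    finally have "\<bar>y k - a k\<bar> \<le> sqrt G" using real_le_rsqrt real_sqrt_le_mono by fastforce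
    moreover have "\<bar>a k\<bar> \<le> real K" using k by (simp add: a_def)
    ultimately show ?thesis unfolding R_def by linarith
  qed
  obtain \<epsilon> where \<epsilon>: "\<epsilon> > 0" "\<And>y k. y \<in> config K \<Longrightarrow> entropy \<alpha> lam K y \<le> entropy \<alpha> lam K a
      \<Longrightarrow> (\<And>j. j \<le> K \<Longrightarrow> \<bar>y j\<bar> \<le> R) \<Longrightarrow> k \<in> {1..K} \<Longrightarrow> \<epsilon> \<le> y k - y (k - 1)"
    using entropy_sublevel_gap[OF assms, where R = R and C = "entropy \<alpha> lam K a"] by blast
  \<comment> \<open>The factor \<open>{undefined}\<close> encodes extensionality and keeps the product over all of \<open>nat\<close> compact.\<close>
  define B where "B = PiE UNIV (\<lambda>k. if k \<le> K then {-R..R} else {undefined})"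
  define S where "S = B \<inter> (\<Inter>k\<in>{1..K}. {x. \<epsilon> \<le> x k - x (k - 1)})"
  have "compactin (product_topology (\<lambda>_. euclidean) UNIV) B"
    unfolding B_def by (subst compactin_PiE) auto
  then have "compact B" by (simp only: euclidean_product_topology compactin_euclidean_iff)
  moreover have "closed (\<Inter>k\<in>{1..K}. {x::nat \<Rightarrow> real. \<epsilon> \<le> x k - x (k - 1)})"
    by (intro closed_INT ballI closed_Collect_le continuous_on_const continuous_on_diff
        continuous_on_coordinate)
  ultimately have "compact S" unfolding S_def by (rule compact_Int_closed)
  have S_config: "x \<in> config K" if x: "x \<in> S" for x
  proof -
    have "x k < x (Suc k)" if "k < K" for k
    proof -
      have "\<epsilon> \<le> x (Suc k) - x (Suc k - 1)" using x that unfolding S_def by fastforce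
      then show ?thesis using \<epsilon>(1) by simp
    qed
    moreover have "x k = undefined" if "\<not> k \<le> K" for k
      using x that unfolding S_def B_def by (auto simp: PiE_iff split: if_splits dest: spec[of _ k])
    ultimately show ?thesis by (auto simp: config_def PiE_def extensional_def)
  qed
  have sub_S: "y \<in> S" if y: "y \<in> config K" "entropy \<alpha> lam K y \<le> entropy \<alpha> lam K a" for y
  proof -
    have "y k \<in> {-R..R}" if "k \<le> K" for k
      using bound[OF y that] by (simp add: abs_le_iff)
    moreover have "y k = undefined" if "\<not> k \<le> K" for k
      using y(1) that by (auto simp: config_def PiE_def extensional_def)
    ultimately have "y \<in> B" unfolding B_def by (intro PiE_I) (simp_all del: atLeastAtMost_iff)
    then show ?thesis using \<epsilon>(2)[OF y bound[OF y]] by (auto simp: S_def)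
  qed
  have "continuous_on S (entropy \<alpha> lam K)"
  proof -
    have "continuous_on S (\<lambda>x. ent \<alpha> (dens K x k))" if k: "k \<in> {1..K}" for k
    proof -
      have "continuous_on {0<..} (\<lambda>d. ent \<alpha> (mesh K / d))"
        using ent_gap_derivative[OF _ mesh_pos[OF assms(3)] assms(1)]
        by (intro DERIV_continuous_on) (auto intro: has_field_derivative_at_within)
      moreover have "continuous_on S (\<lambda>x. x k - x (k - 1))"
        by (intro continuous_on_diff continuous_on_coordinate)
      moreover have "(\<lambda>x. x k - x (k - 1)) ` S \<subseteq> {0<..}"
      proof (rule image_subsetI)
        fix x assume "x \<in> S"
        then show "x k - x (k - 1) \<in> {0<..}"
          using config_gap_pos[OF S_config, of x k] k by simp
      qed
      ultimately have "continuous_on S (\<lambda>x. ent \<alpha> (mesh K / (x k - x (k - 1))))"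
        by (rule continuous_on_compose2)
      then show ?thesis using k by (simp add: dens_interior)
    qed
    then show ?thesis unfolding entropy_def dnorm_squared
      by (intro continuous_intros continuous_on_coordinate) auto
  qed
  moreover have "a \<in> S" using sub_S[OF a] by simp
  ultimately obtain m where m: "m \<in> S" "\<And>y. y \<in> S \<Longrightarrow> entropy \<alpha> lam K m \<le> entropy \<alpha> lam K y"
    using continuous_attains_inf[OF \<open>compact S\<close>] by blast
  have "entropy \<alpha> lam K m \<le> entropy \<alpha> lam K y" if "y \<in> config K" for y
    using m(2)[OF sub_S[OF that]] m(2)[OF \<open>a \<in> S\<close>] by linarith
  then show ?thesis using S_config[OF m(1)] by (auto simp: is_arg_min_linorder)
qed

section \<open>The information in terms of entropy and gradient\<close>

lemma flux_gap:
  assumes "x \<in> config K" "K \<ge> 1" "k \<in> {1..K}"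
  shows "flux \<alpha> K x k * (x k - x (k - 1)) = mesh K * dens K x k powr (\<alpha> - 1/2)"
proof -
  define d where "d = x k - x (k - 1)"
  have d: "d > 0" "mesh K > 0" using config_gap_pos[OF assms(1)] mesh_pos assms by (auto simp: d_def)
  have "(mesh K / d) powr (\<alpha> + 1/2) = (mesh K / d) powr (\<alpha> - 1/2) * (mesh K / d) powr 1"
    by (simp only: powr_add[symmetric]) (simp add: add.commute)
  moreover have "dens K x k = mesh K / d" using assms(3) by (simp add: dens_interior d_def)
  ultimately show ?thesis using d unfolding flux_def d_def[symmetric] by simp
qed

text \<open>
  The square of the gradient is expanded, and its mixed term, proportional to
  \<open>\<Sum>k. x k (w (k + 1) - w k) = - \<Sum>k. w k (x k - x (k - 1))\<close>, is evaluated by \<open>flux_gap\<close>. The remaining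
  multiple of \<open>\<parallel>x\<parallel>\<^sup>2\<close> comes from \<open>lam / 2 - \<Lambda>\<^sup>2 = (2 \<alpha> - 1) \<Lambda>\<^sup>2 / 2\<close>.
\<close>
lemma information_eq_gradient:
  assumes "1/2 \<le> \<alpha>" "lam > 0" "K \<ge> 1" "x \<in> config K"
  shows "information \<alpha> lam K x = mesh K * (\<Sum>k=0..K. (grad \<alpha> lam K x k)\<^sup>2)
    + 2 * Theta \<alpha> * Lambda \<alpha> lam * (mesh K * (\<Sum>k=1..K. dens K x k powr (\<alpha> - 1/2)))
    + (2 * \<alpha> - 1) * (Lambda \<alpha> lam)\<^sup>2 / 2 * (dnorm K x)\<^sup>2"
proof -
  define T where "T = Theta \<alpha>"
  define L where "L = Lambda \<alpha> lam"
  define D where "D k = flux \<alpha> K x (Suc k) - flux \<alpha> K x k" for k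
  have mp: "mesh K > 0" using mesh_pos[OF assms(3)] .
  have "(\<Sum>k=0..K. (grad \<alpha> lam K x k)\<^sup>2)
      = (\<Sum>k=0..K. T\<^sup>2 * (D k / mesh K)\<^sup>2 + 2 * T * L / mesh K * (x k * D k) + L\<^sup>2 * (x k)\<^sup>2)"
    by (intro sum.cong) (auto simp: grad_def power2_sum power_mult_distrib power_divide simp flip: T_def L_def D_def)
  also have "\<dots> = T\<^sup>2 * (\<Sum>k=0..K. (D k / mesh K)\<^sup>2) + 2 * T * L / mesh K * (\<Sum>k=0..K. x k * D k)
      + L\<^sup>2 * (\<Sum>k=0..K. (x k)\<^sup>2)"
    by (simp add: sum.distrib sum_distrib_left)
  also have "(\<Sum>k=0..K. x k * D k) = - (\<Sum>k=1..K. mesh K * dens K x k powr (\<alpha> - 1/2))"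
    unfolding D_def sum_flux_by_parts using flux_gap[OF assms(4,3)] by simp
  also have "\<dots> = - mesh K * (\<Sum>k=1..K. dens K x k powr (\<alpha> - 1/2))"
    by (simp add: sum_distrib_left sum_negf)
  finally have g: "(\<Sum>k=0..K. (grad \<alpha> lam K x k)\<^sup>2) = T\<^sup>2 * (\<Sum>k=0..K. (D k / mesh K)\<^sup>2)
      - 2 * T * L * (\<Sum>k=1..K. dens K x k powr (\<alpha> - 1/2)) + L\<^sup>2 * (\<Sum>k=0..K. (x k)\<^sup>2)"
    using mp by simp
  have lam: "lam = (2 * \<alpha> + 1) * L\<^sup>2" using Lambda_squared assms by (simp add: L_def)
  have "information \<alpha> lam K x = T\<^sup>2 * mesh K * (\<Sum>k=0..K. (D k / mesh K)\<^sup>2)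
      + (2 * \<alpha> + 1) * L\<^sup>2 / 2 * (mesh K * (\<Sum>k=0..K. (x k)\<^sup>2))"
    unfolding information_def dnorm_squared T_def D_def flux_def Suc_eq_plus1
    by (subst lam) simp
  then show ?thesis unfolding g dnorm_squared T_def[symmetric] L_def[symmetric]
    by (simp add: field_simps)
qed

text \<open>
  For \<open>\<alpha> > 1/2\<close> the sum of powers in \<open>information_eq_gradient\<close> is a multiple of the sum in the
  entropy, with exactly the factor that matches the term in \<open>\<parallel>x\<parallel>\<^sup>2\<close>. For \<open>\<alpha> = 1/2\<close> every power is \<open>1\<close> and
  the sum disappears only in the difference, which is why the identity is stated for differences.
\<close>
lemma information_diff:
  assumes "1/2 \<le> \<alpha>" "lam > 0" "K \<ge> 1" "x \<in> config K" "y \<in> config K"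
  shows "information \<alpha> lam K x - information \<alpha> lam K y
    = mesh K * (\<Sum>k=0..K. (grad \<alpha> lam K x k)\<^sup>2) - mesh K * (\<Sum>k=0..K. (grad \<alpha> lam K y k)\<^sup>2)
      + (2 * \<alpha> - 1) * Lambda \<alpha> lam * (entropy \<alpha> lam K x - entropy \<alpha> lam K y)"
proof (cases "\<alpha> = 1/2")
  case True
  have "(\<Sum>k=1..K. dens K z k powr (\<alpha> - 1/2)) = real K" if "z \<in> config K" for z
  proof -
    have "dens K z k powr 0 = 1" if "k \<in> {1..K}" for k
      using that config_gap_pos[OF \<open>z \<in> config K\<close>, of k] mesh_pos[OF assms(3)]
      by (simp add: dens_interior)
    then show ?thesis by (simp add: True)
  qed
  then show ?thesis
    using information_eq_gradient[OF assms(1-4)] information_eq_gradient[OF assms(1-3,5)] assms(4,5)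
    by (simp add: True)
next
  case False
  have "information \<alpha> lam K z = mesh K * (\<Sum>k=0..K. (grad \<alpha> lam K z k)\<^sup>2)
      + (2 * \<alpha> - 1) * Lambda \<alpha> lam * entropy \<alpha> lam K z" if z: "z \<in> config K" for z
  proof -
    have "Theta \<alpha> * dens K z k powr (\<alpha> - 1/2) = (\<alpha> - 1/2) * ent \<alpha> (dens K z k)" for k
      using False by (simp add: ent_def)
    then have "Theta \<alpha> * (\<Sum>k=1..K. dens K z k powr (\<alpha> - 1/2)) = (\<alpha> - 1/2) * (\<Sum>k=1..K. ent \<alpha> (dens K z k))"
      by (simp add: sum_distrib_left)
    then have "2 * Lambda \<alpha> lam * mesh K * (Theta \<alpha> * (\<Sum>k=1..K. dens K z k powr (\<alpha> - 1/2)))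
       = 2 * Lambda \<alpha> lam * mesh K * ((\<alpha> - 1/2) * (\<Sum>k=1..K. ent \<alpha> (dens K z k)))"
      by (rule arg_cong)
    then have "2 * Theta \<alpha> * Lambda \<alpha> lam * (mesh K * (\<Sum>k=1..K. dens K z k powr (\<alpha> - 1/2)))
       = 2 * Lambda \<alpha> lam * mesh K * ((\<alpha> - 1/2) * (\<Sum>k=1..K. ent \<alpha> (dens K z k)))"
      by (simp only: mult_ac)
    then show ?thesis
      unfolding information_eq_gradient[OF assms(1-3) z] entropy_def
      by (simp add: power2_eq_square algebra_simps)
  qed
  from this[OF assms(4)] this[OF assms(5)] show ?thesis by (simp add: algebra_simps)
qed

theorem corollary9:
  fixes \<alpha> lam :: real and K :: nat
  assumes "1/2 \<le> \<alpha>" and "\<alpha> \<le> 1" and "lam > 0" and "K \<ge> 1"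
  shows "(\<exists>!m. is_arg_min (entropy \<alpha> lam K) (\<lambda>x. x \<in> config K) m) \<and>
    (\<forall>m. is_arg_min (entropy \<alpha> lam K) (\<lambda>x. x \<in> config K) m \<longrightarrow>
       is_arg_min (information \<alpha> lam K) (\<lambda>x. x \<in> config K) m \<and>
       (\<forall>x\<in>config K. information \<alpha> lam K x - information \<alpha> lam K m
          \<le> (2 * \<alpha> + 1) / 2 * (dnorm K (dgrad K (entropy \<alpha> lam K) x))\<^sup>2))"
proof (intro conjI allI impI)
  show "\<exists>!m. is_arg_min (entropy \<alpha> lam K) (\<lambda>x. x \<in> config K) m"
    using entropy_minimizer_exists[OF assms(1,3,4)] entropy_minimizer_unique[OF assms(1,3,4)]
    by (rule ex_ex1I)
next
  fix m assume min: "is_arg_min (entropy \<alpha> lam K) (\<lambda>x. x \<in> config K) m"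
  then have m: "m \<in> config K" and le: "\<And>x. x \<in> config K \<Longrightarrow> entropy \<alpha> lam K m \<le> entropy \<alpha> lam K x"
    by (auto simp: is_arg_min_linorder)
  have diff: "information \<alpha> lam K x - information \<alpha> lam K m
      = (dnorm K (dgrad K (entropy \<alpha> lam K) x))\<^sup>2
        + (2 * \<alpha> - 1) * Lambda \<alpha> lam * (entropy \<alpha> lam K x - entropy \<alpha> lam K m)"
    if x: "x \<in> config K" for x
    using information_diff[OF assms(1,3,4) x m] grad_minimizer_eq_0[OF assms(1,4) min]
    by (simp add: dnorm_dgrad_entropy[OF assms(1,4) x])
  have "information \<alpha> lam K m \<le> information \<alpha> lam K x" if x: "x \<in> config K" for x
  proof -
    have "0 \<le> (2 * \<alpha> - 1) * Lambda \<alpha> lam * (entropy \<alpha> lam K x - entropy \<alpha> lam K m)"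
      using le[OF x] Lambda_pos[OF assms(1,3)] assms(1) by simp
    then have "0 \<le> information \<alpha> lam K x - information \<alpha> lam K m"
      unfolding diff[OF x] by simp
    then show ?thesis by simp
  qed
  then show "is_arg_min (information \<alpha> lam K) (\<lambda>x. x \<in> config K) m"
    using m by (auto simp: is_arg_min_linorder)
  show "\<forall>x\<in>config K. information \<alpha> lam K x - information \<alpha> lam K m
          \<le> (2 * \<alpha> + 1) / 2 * (dnorm K (dgrad K (entropy \<alpha> lam K) x))\<^sup>2"
  proof
    fix x assume x: "x \<in> config K"
    have "(2 * \<alpha> - 1) / 2 * (2 * Lambda \<alpha> lam * (entropy \<alpha> lam K x - entropy \<alpha> lam K m))
        \<le> (2 * \<alpha> - 1) / 2 * (dnorm K (dgrad K (entropy \<alpha> lam K) x))\<^sup>2"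
      using entropy_gradient_domination[OF assms(1,3,4) x m] assms(1)
      by (intro mult_left_mono) (auto simp: dnorm_dgrad_entropy[OF assms(1,4) x])
    then show "information \<alpha> lam K x - information \<alpha> lam K m
          \<le> (2 * \<alpha> + 1) / 2 * (dnorm K (dgrad K (entropy \<alpha> lam K) x))\<^sup>2"
      unfolding diff[OF x] by (simp add: field_simps)
  qed
qed

end
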